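(* Consider a layered computational graph with terminal vector feedback and backpropagated gradients $\mathbf g_v$, parameter gradients $\mathbf g_v^{\theta}$ as described in the context. Assume condition (A) fails and condition (B) holds, that is: (not A.1) for every terminal node $v\in V_L$, $\mathbf g_v$ is almost surely a deterministic function of $\mathbf x_v$; (not A.2) every node performs a deterministic computation (no auxiliary noise $\xi_v$); (not A.3) every non-input node $v\in V_l$, $1\le l\le L$, satisfies $\mathrm{pa}(v)=V_{l-1}$; (B) for every non-input node $v$ and every subset $U\subseteq \mathrm{an}_{\mathrm{sib}}(v)$, $\mathbb E[\mathbf g_v\mid \mathbf z_v]=\mathbb E[\mathbf g_v\mid \mathbf z_v,\mathbf Z_U]$ almost surely. Let $v\in V$ be any non-input node and let $\tilde{\mathbf g}_v^{\theta}$ be any random vector (with finite second moment) that is conditionally unbiased: $\mathbb E[\tilde{\mathbf g}_v^{\theta}\mid \mathbf z_v]=\mathbb E[\mathbf g_v^{\theta}\mid \mathbf z_v]$. For $n\ge 1$ let $\hat{\tilde{\mathbf g}}_v^{\theta}$ be the empirical mean of $n$ i.i.d. samples of $\tilde{\mathbf g}_v^{\theta}$ and let $\hat{\mathbf g}_v^{\theta}$ be the empirical mean of $n$ i.i.d. samples of the backpropagated parameter gradient $\mathbf g_v^{\theta}$. Then $$\tilde\Delta_v^2:=\mathbb E\bigl\|\hat{\tilde{\mathbf g}}_v^{\theta}-\mathbb E\,\mathbf g_v^{\theta}\bigr\|_2^2\ \ \ge\ \ \Delta_v^2:=\mathbb E\bigl\|\hat{\mathbf g}_v^{\theta}-\mathbb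 E\,\mathbf g_v^{\theta}\bigr\|_2^2 .$$
   Context: Layered graph. $G=(V,E)$ is a finite layered DAG, $V=\bigcup_{l=0}^L V_l$, edges go only from a layer to the next; $\mathrm{pa}(v)\subseteq V_{l-1}$ and $\mathrm{ch}(v)\subseteq V_{l+1}$ denote the parents and children of $v\in V_l$. Nodes in $V_0$ are input nodes, nodes in $V_L$ are terminal nodes. Each node $v$ carries a random vector $\mathbf x_v\in\mathbb R^{d_v}$. Input variables $(\mathbf x_v)_{v\in V_0}$ are drawn from an external distribution, and for input nodes $\mathbf z_v:=\mathbf x_v$. For a non-input node, $\mathbf x_v=f_v(\mathbf z_v;\theta_v)$ with $f_v$ differentiable, $\theta_v$ a local (deterministic) parameter vector, and local observation $\mathbf z_v:=((\mathbf x_{v^-})_{v^-\in \mathrm{pa}(v)},\xi_v)$, where $\xi_v$ is an optional auxiliary random variable, independent of everything else, which governs the stochastic behaviour of $v$; the node performs a deterministic computation if there is no $\xi_v$. All random variables are assumed to have finite second moments. Backpropagation. Each terminal node $v\in V_L$ is given an external random feedback vector $\mathbf g_v\in\mathbb R^{d_v}$. For a non-terminal node, $\mathbf g_v=\sum_{v^+\in \mathrm{ch}(v)}\mathbf J_v^{v^+}\mathbf g_{v^+}$, where $\mathbf J_v^{v^+}:=(\partial \mathbf x_{v^+}/\partial \mathbf x_v)^\top$ is the transposed Jacobian of the local computation at $v^+$ (a function of $\mathbf z_{v^+}$). For a non-input node, the parameter gradient is $\mathbf g_v^\theta:=\mathbf J_v^\theta \mathbf g_v$ with $\mathbf J_v^\theta:=(\partial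 \mathbf x_v/\partial\theta_v)^\top$ (a function of $\mathbf z_v$). Extended ancestors. For a non-input node $v\in V_l$, $\mathrm{sib}(v):=\{v'\in V_l:\mathrm{pa}(v')\cap \mathrm{pa}(v)\ne\varnothing\}$ (with $v$ itself included). Define $\mathrm{an}_{\mathrm{sib}}(v):=\bigl(\bigcup_{v^-\in \mathrm{pa}(\mathrm{sib}(v))}\mathrm{an}_{\mathrm{sib}}(v^-)\bigr)\cup \mathrm{sib}(v)$ recursively, where $\mathrm{pa}(\mathrm{sib}(v))$ is the set of all parents of nodes in $\mathrm{sib}(v)$ and $\mathrm{an}_{\mathrm{sib}}(v):=\varnothing$ for input nodes. For $U\subseteq V$, $\mathbf Z_U:=\{\mathbf z_u:u\in U\}$. *)

theory Defs
  imports "HOL-Probability.Probability"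
begin

text \<open>
  The dimensions \<open>d\<^sub>v\<close> depend on the node \<open>v\<close>. The space of vectors of dimension \<open>d\<^sub>v\<close> is the
  coordinate subspace \<open>coord_space C\<close> of one ambient space \<open>real ^ 'k\<close>, for a set of coordinates
  \<open>C\<close> with \<open>card C = d\<^sub>v\<close>. Since \<open>'k\<close> is an arbitrary finite type and the graph is finite,
  this allows every choice of dimensions.
\<close>

definition coord_space :: "'k::finite set \<Rightarrow> (real ^ 'k) set" where
  "coord_space C = {x. \<forall>i. i \<notin> C \<longrightarrow> x $ i = 0}"

definition coord_proj :: "'k::finite set \<Rightarrow> real ^ 'k \<Rightarrow> real ^ 'k" where
  "coord_proj C x = (\<chi> i. if i \<in> C then x $ i else 0)"

definition finite_second_moment ::
    "'w measure \<Rightarrow> ('w \<Rightarrow> 'b::{real_normed_vector, second_countable_topology}) \<Rightarrow> bool" where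
  "finite_second_moment M X \<longleftrightarrow>
     X \<in> borel_measurable M \<and> integrable M (\<lambda>\<omega>. (norm (X \<omega>))\<^sup>2)"

definition vec_cond_exp ::
    "'w measure \<Rightarrow> 'w measure \<Rightarrow> ('w \<Rightarrow> real ^ 'k::finite) \<Rightarrow> 'w \<Rightarrow> real ^ 'k" where
  "vec_cond_exp M F X \<omega> = (\<chi> i. real_cond_exp M F (\<lambda>\<omega>'. X \<omega>' $ i) \<omega>)"

text \<open>\<open>S 0, \<dots>, S (n - 1)\<close> are i.i.d. copies of \<open>X\<close>; they may live on a probability space of their
  own, \<open>M'\<close>.\<close>

definition iid_samples ::
    "'w measure \<Rightarrow> ('w \<Rightarrow> 'b::{real_normed_vector, second_countable_topology}) \<Rightarrow>
     'w2 measure \<Rightarrow> nat \<Rightarrow> (nat \<Rightarrow> 'w2 \<Rightarrow> 'b) \<Rightarrow> bool" where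
  "iid_samples M X M' n S \<longleftrightarrow>
     prob_space M' \<and>
     prob_space.indep_vars M' (\<lambda>_. borel) S {..<n} \<and>
     (\<forall>k<n. distr M' borel (S k) = distr M borel X)"

definition empirical_mean :: "nat \<Rightarrow> (nat \<Rightarrow> 'w2 \<Rightarrow> 'b::real_normed_vector) \<Rightarrow> 'w2 \<Rightarrow> 'b" where
  "empirical_mean n S \<omega> = (1 / real n) *\<^sub>R (\<Sum>k<n. S k \<omega>)"

text \<open>
  The vertex set is the finite type \<open>'v\<close>. Node \<open>v\<close> carries a vector in
  \<open>coord_space (coords N v)\<close> and its parameters lie in \<open>coord_space (pcoords N v)\<close>.
  The local function takes the local observation (the parents' vectors, stored in their slots of
  \<open>real ^ 'k ^ 'v\<close>, together with the value of the noise) and the parameter vector.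
  Auxiliary noise is present exactly at the nodes in \<open>noisy N\<close>; the field \<open>noise\<close> is not used
  elsewhere. The fields \<open>act\<close> and \<open>grad\<close> are the random vectors \<open>x\<^sub>v\<close> and \<open>g\<^sub>v\<close>; they are
  determined by the inputs, the noise and the terminal feedback through the equations in
  \<open>backprop_network\<close>.
\<close>

record ('v, 'k, 'p, 'q, 'w) network =
  depth :: nat
  layer :: "'v \<Rightarrow> nat"
  edges :: "('v \<times> 'v) set"
  coords :: "'v \<Rightarrow> 'k set"
  pcoords :: "'v \<Rightarrow> 'p set"
  param :: "'v \<Rightarrow> real ^ 'p"
  node_fun :: "'v \<Rightarrow> (real ^ 'k ^ 'v) \<times> (real ^ 'q) \<Rightarrow> real ^ 'p \<Rightarrow> real ^ 'k"
  noisy :: "'v set"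
  noise :: "'v \<Rightarrow> 'w \<Rightarrow> real ^ 'q"
  act :: "'v \<Rightarrow> 'w \<Rightarrow> real ^ 'k"
  grad :: "'v \<Rightarrow> 'w \<Rightarrow> real ^ 'k"

context
  fixes N :: "('v::finite, 'k::finite, 'p::finite, 'q::finite, 'w) network"
begin

definition parents :: "'v \<Rightarrow> 'v set" where
  "parents v = {u. (u, v) \<in> edges N}"

definition children :: "'v \<Rightarrow> 'v set" where
  "children v = {w. (v, w) \<in> edges N}"

definition obs :: "'v \<Rightarrow> 'w \<Rightarrow> (real ^ 'k ^ 'v) \<times> (real ^ 'q)" where
  "obs v \<omega> =
     (if layer N v = 0 then (\<chi> u. if u = v then act N v \<omega> else 0, 0)
      else (\<chi> u. if u \<in> parents v then act N u \<omega> else 0, if v \<in> noisy N then noise N v \<omega> else 0))"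

text \<open>The transposed Jacobian at the child \<open>w\<close> with respect to the vector of its parent \<open>v\<close>, as a
  function of the local observation of \<open>w\<close>.\<close>

definition jac_act :: "'v \<Rightarrow> 'v \<Rightarrow> (real ^ 'k ^ 'v) \<times> (real ^ 'q) \<Rightarrow> real ^ 'k ^ 'k" where
  "jac_act v w z =
     transpose (jacobian
       (\<lambda>y. node_fun N w (\<chi> u. if u = v then y else fst z $ u, snd z) (param N w))
       (at (fst z $ v)))"

definition jac_param :: "'v \<Rightarrow> (real ^ 'k ^ 'v) \<times> (real ^ 'q) \<Rightarrow> real ^ 'k ^ 'p" where
  "jac_param v z = transpose (jacobian (node_fun N v z) (at (param N v)))"

definition param_grad :: "'v \<Rightarrow> 'w \<Rightarrow> real ^ 'p" where
  "param_grad v \<omega> = jac_param v (obs v \<omega>) *v grad N v \<omega>"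

definition sib :: "'v \<Rightarrow> 'v set" where
  "sib v = insert v {v'. layer N v' = layer N v \<and> parents v' \<inter> parents v \<noteq> {}}"

inductive ext_anc :: "'v \<Rightarrow> 'v \<Rightarrow> bool" where
  ext_anc_sib: "0 < layer N v \<Longrightarrow> u \<in> sib v \<Longrightarrow> ext_anc u v"
| ext_anc_step:
    "0 < layer N v \<Longrightarrow> w \<in> sib v \<Longrightarrow> p \<in> parents w \<Longrightarrow> ext_anc u p \<Longrightarrow> ext_anc u v"

text \<open>The least solution of the recursion for the extended ancestors; on a layered graph it is the
  only one.\<close>

definition an_sib :: "'v \<Rightarrow> 'v set" where
  "an_sib v = {u. ext_anc u v}"

lemma an_sib_input: "layer N v = 0 \<Longrightarrow> an_sib v = {}"
  by (auto simp: an_sib_def elim: ext_anc.cases)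

lemma an_sib_rec:
  "0 < layer N v \<Longrightarrow> an_sib v = (\<Union>p \<in> (\<Union>w \<in> sib v. parents w). an_sib p) \<union> sib v"
  unfolding an_sib_def by (subst ext_anc.simps) auto

definition obs_algebra :: "'w measure \<Rightarrow> 'v set \<Rightarrow> 'w measure" where
  "obs_algebra M U =
     sigma (space M) (\<Union>u\<in>U. {obs u -` A \<inter> space M | A. A \<in> sets borel})"

definition layered_graph :: bool where
  "layered_graph \<longleftrightarrow>
     (\<forall>v. layer N v \<le> depth N) \<and>
     (\<forall>u v. (u, v) \<in> edges N \<longrightarrow> layer N v = Suc (layer N u))"

text \<open>
  The local functions live on the ambient spaces. That they depend only on the coordinates of the
  parents and of the parameters of \<open>v\<close> makes all derivatives in the remaining directions vanish,
  so that the Jacobians above are the Jacobians between the coordinate subspaces, padded by zeros.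
\<close>

definition local_functions :: bool where
  "local_functions \<longleftrightarrow>
     (\<forall>v. 0 < layer N v \<longrightarrow>
        (\<forall>z t. node_fun N v z t \<in> coord_space (coords N v)) \<and>
        (\<forall>z t. node_fun N v z t =
           node_fun N v
             (\<chi> u. if u \<in> parents v then coord_proj (coords N u) (fst z $ u) else 0, snd z)
             (coord_proj (pcoords N v) t)) \<and>
        (\<forall>z t. (\<lambda>(z', t'). node_fun N v z' t') differentiable (at (z, t))) \<and>
        param N v \<in> coord_space (pcoords N v))"

text \<open>The terminal feedback may depend on the outputs, hence on the noise, so it is not part of the
  vector from which the noise is independent.\<close>

definition independent_noise :: "'w measure \<Rightarrow> bool" where
  "independent_noise M \<longleftrightarrow>
     (\<forall>v\<in>noisy N. prob_space.indep_set M
        (sets (vimage_algebra (space M) (noise N v) borel))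
        (sets (vimage_algebra (space M)
           (\<lambda>\<omega>. ((\<chi> u. if layer N u = 0 then act N u \<omega> else 0) :: real ^ 'k ^ 'v,
                 (\<chi> u. if u \<in> noisy N - {v} then noise N u \<omega> else 0) :: real ^ 'q ^ 'v))
           borel)))"

definition backprop_network :: "'w measure \<Rightarrow> bool" where
  "backprop_network M \<longleftrightarrow>
     prob_space M \<and> layered_graph \<and> local_functions \<and>
     noisy N \<subseteq> {v. 0 < layer N v} \<and> independent_noise M \<and>
     (\<forall>v. \<forall>\<omega>\<in>space M. layer N v = 0 \<longrightarrow> act N v \<omega> \<in> coord_space (coords N v)) \<and>
     (\<forall>v. \<forall>\<omega>\<in>space M. 0 < layer N v \<longrightarrow> act N v \<omega> = node_fun N v (obs v \<omega>) (param N v)) \<and>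
     (\<forall>v. \<forall>\<omega>\<in>space M. layer N v = depth N \<longrightarrow> grad N v \<omega> \<in> coord_space (coords N v)) \<and>
     (\<forall>v. \<forall>\<omega>\<in>space M. layer N v < depth N \<longrightarrow>
        grad N v \<omega> = (\<Sum>w\<in>children v. jac_act v w (obs w \<omega>) *v grad N w \<omega>)) \<and>
     (\<forall>v. finite_second_moment M (act N v) \<and> finite_second_moment M (grad N v)) \<and>
     (\<forall>v\<in>noisy N. finite_second_moment M (noise N v)) \<and>
     (\<forall>v. 0 < layer N v \<longrightarrow> finite_second_moment M (param_grad v))"

end

end

theory Submission
  imports Defs
begin

text \<open>
  In a fully connected deterministic network all nodes of a layer have the same local observation,
  and it determines every activation downstream. By induction from the terminal layer, \<open>g\<^sub>v\<close>, and
  hence \<open>g\<^sub>v\<^sup>\<theta>\<close>, is therefore almost surely a function of \<open>z\<^sub>v\<close>. So \<open>g\<^sub>v\<^sup>\<theta>\<close> is the conditional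
  expectation of every conditionally unbiased estimator given \<open>z\<^sub>v\<close>, and conditional expectation
  does not increase the variance. Averaging \<open>n\<close> i.i.d. samples divides both variances by \<open>n\<close>.
\<close>

section \<open>Measurability of Jacobians\<close>

lemma borel_measurable_vec:
  fixes f :: "'a \<Rightarrow> 'b::euclidean_space ^ 'n"
  assumes "\<And>i. (\<lambda>x. f x $ i) \<in> borel_measurable M"
  shows "f \<in> borel_measurable M"
proof (subst borel_measurable_euclidean_space, rule ballI)
  fix b :: "'b ^ 'n" assume "b \<in> Basis"
  then obtain i u where b: "b = axis i u"
    by (auto simp: Basis_vec_def)
  show "(\<lambda>x. f x \<bullet> b) \<in> borel_measurable M"
    using assms[of i] by (simp add: b inner_axis)
qed

lemma borel_measurable_vec_nth:
  fixes f :: "'a \<Rightarrow> 'b::euclidean_space ^ 'n"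
  assumes "f \<in> borel_measurable M"
  shows "(\<lambda>x. f x $ i) \<in> borel_measurable M"
  by (rule measurable_compose[OF assms borel_measurable_continuous_onI])
    (intro continuous_intros)

lemma borel_measurable_matrix_vector_mult:
  fixes A :: "'a \<Rightarrow> real ^ 'n ^ 'm" and x :: "'a \<Rightarrow> real ^ 'n"
  assumes "A \<in> borel_measurable M" "x \<in> borel_measurable M"
  shows "(\<lambda>\<omega>. A \<omega> *v x \<omega>) \<in> borel_measurable M"
proof (rule borel_measurable_vec)
  fix i
  show "(\<lambda>\<omega>. (A \<omega> *v x \<omega>) $ i) \<in> borel_measurable M"
    unfolding matrix_vector_mult_def vec_lambda_beta
    by (intro borel_measurable_sum borel_measurable_times borel_measurable_vec_nth assms)
qed

text \<open>A Jacobian entry is the derivative at 0 of one coordinate of \<open>f\<close> along the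
  line through \<open>a\<close> in direction \<open>axis j 1\<close>. Restricting the difference
  quotient to the step sizes 1/(n+1) replaces the limit by a countable one, which is the form that
  preserves measurability.\<close>

lemma jacobian_component_LIMSEQ:
  fixes f :: "real ^ 'n \<Rightarrow> real ^ 'm"
  assumes "f differentiable (at a)"
  shows "(\<lambda>n. real (Suc n) * (f (a + (1 / real (Suc n)) *\<^sub>R axis j 1) $ i - f a $ i))
           \<longlonglongrightarrow> jacobian f (at a) $ i $ j"
proof -
  let ?D = "frechet_derivative f (at a)"
  have "(f has_derivative ?D) (at a)"
    using assms by (simp add: frechet_derivative_works)
  \<comment> \<open>The base point is written as the value of the line at parameter 0, so that the
    chain rule along the line matches it.\<close>
  then have "((\<lambda>x. f x $ i) has_derivative (\<lambda>h. ?D h $ i)) (at (a + 0 *\<^sub>R axis j 1))"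
    by (simp add: bounded_linear.has_derivative[OF bounded_linear_vec_nth])
  then have "((\<lambda>t. f (a + t *\<^sub>R axis j 1) $ i) has_derivative (\<lambda>t. ?D (t *\<^sub>R axis j 1) $ i)) (at 0)"
    by (rule has_derivative_compose[rotated]) (auto intro!: derivative_eq_intros)
  moreover have "?D (t *\<^sub>R axis j 1) $ i = jacobian f (at a) $ i $ j * t" for t
    using linear_frechet_derivative[OF assms]
    by (simp add: linear_cmul jacobian_def matrix_def)
  ultimately have "((\<lambda>t. f (a + t *\<^sub>R axis j 1) $ i)
      has_field_derivative jacobian f (at a) $ i $ j) (at 0)"
    by (simp add: has_field_derivative_def)
  then have "((\<lambda>t. (f (a + t *\<^sub>R axis j 1) $ i - f a $ i) / t)
      \<longlongrightarrow> jacobian f (at a) $ i $ j) (at 0)"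
    by (simp add: has_field_derivative_iff)
  \<comment> \<open>The steps tend to 0 without ever being 0, as the punctured limit requires;
    \<open>Suc n\<close> also avoids a division by zero at the first index.\<close>
  moreover have "filterlim (\<lambda>n. 1 / real (Suc n)) (at 0) sequentially"
    using LIMSEQ_inverse_real_of_nat
    by (auto simp: filterlim_at inverse_eq_divide)
  ultimately have "(\<lambda>n. (f (a + (1 / real (Suc n)) *\<^sub>R axis j 1) $ i - f a $ i) / (1 / real (Suc n)))
      \<longlonglongrightarrow> jacobian f (at a) $ i $ j"
    by (rule filterlim_compose)
  then show ?thesis
    by (simp add: mult.commute)
qed

text \<open>Each entry is a pointwise limit of difference quotients that are measurable in
  \<open>z\<close>. The base point \<open>a z\<close> moves with \<open>z\<close>, but the shifts in
  the quotients are constant vectors, so measurability is asked for one fixed \<open>h\<close> at a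
  time.\<close>

lemma borel_measurable_jacobian:
  fixes F :: "'a \<Rightarrow> real ^ 'n \<Rightarrow> real ^ 'm"
  assumes diff: "\<And>z. z \<in> space M \<Longrightarrow> F z differentiable (at (a z))"
    and meas: "\<And>h. (\<lambda>z. F z (a z + h)) \<in> borel_measurable M"
  shows "(\<lambda>z. jacobian (F z) (at (a z))) \<in> borel_measurable M"
proof (intro borel_measurable_vec)
  fix i j
  have m: "(\<lambda>z. F z (a z + h) $ i) \<in> borel_measurable M" for h
    by (rule borel_measurable_vec_nth[OF meas])
  show "(\<lambda>z. jacobian (F z) (at (a z)) $ i $ j) \<in> borel_measurable M"
  proof (rule borel_measurable_LIMSEQ_real)
    show "(\<lambda>n. real (Suc n) * (F z (a z + (1 / real (Suc n)) *\<^sub>R axis j 1) $ i - F z (a z) $ i))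
        \<longlonglongrightarrow> jacobian (F z) (at (a z)) $ i $ j" if "z \<in> space M" for z
      by (rule jacobian_component_LIMSEQ[OF diff[OF that]])
    show "(\<lambda>z. real (Suc n) * (F z (a z + (1 / real (Suc n)) *\<^sub>R axis j 1) $ i - F z (a z) $ i))
        \<in> borel_measurable M" for n
      \<comment> \<open>The instance with shift 0 covers the unshifted term
        \<open>F z (a z)\<close>.\<close>
      using m m[of 0] by (intro borel_measurable_times borel_measurable_diff) simp_all
  qed
qed

lemma borel_measurable_transpose:
  fixes A :: "'a \<Rightarrow> real ^ 'n ^ 'm"
  assumes "A \<in> borel_measurable M"
  shows "(\<lambda>x. transpose (A x)) \<in> borel_measurable M"
  unfolding transpose_def
  by (intro borel_measurable_vec) (simp add: borel_measurable_vec_nth assms)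

section \<open>The error of an empirical mean\<close>

text \<open>On a finite measure space constants are integrable, and the norm is dominated by one
  plus its square.\<close>

lemma integrable_finite_second_moment:
  fixes X :: "'a \<Rightarrow> 'b::euclidean_space"
  assumes "finite_measure M" "finite_second_moment M X"
  shows "integrable M X"
proof (rule Bochner_Integration.integrable_bound)
  interpret finite_measure M by fact
  show "integrable M (\<lambda>\<omega>. 1 + (norm (X \<omega>))\<^sup>2)"
    using assms by (simp add: finite_second_moment_def)
  show "X \<in> borel_measurable M"
    using assms by (simp add: finite_second_moment_def)
  \<comment> \<open>Expanding the square of t - 1/2 gives the bound even with 1/4 in place of
    1.\<close>
  have "t \<le> 1 + t\<^sup>2" for t :: real
    using zero_le_power2[of "t - 1/2"] by (simp add: power2_eq_square algebra_simps)
  then show "AE \<omega> in M. norm (X \<omega>) \<le> norm (1 + (norm (X \<omega>))\<^sup>2)"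
    by (auto intro!: AE_I2 order_trans[OF _ abs_ge_self])
qed

lemma integrable_finite_second_moment_mult:
  fixes f g :: "'a \<Rightarrow> real"
  assumes "finite_second_moment M f" "finite_second_moment M g"
  shows "integrable M (\<lambda>\<omega>. f \<omega> * g \<omega>)"
proof (rule Bochner_Integration.integrable_bound)
  show "integrable M (\<lambda>\<omega>. (f \<omega>)\<^sup>2 + (g \<omega>)\<^sup>2)"
    using assms by (simp add: finite_second_moment_def)
  show "(\<lambda>\<omega>. f \<omega> * g \<omega>) \<in> borel_measurable M"
    using assms by (auto simp: finite_second_moment_def intro: borel_measurable_times)
  have "\<bar>s * t\<bar> \<le> s\<^sup>2 + t\<^sup>2" for s t :: real
  proof -
    have "2 * (\<bar>s\<bar> * \<bar>t\<bar>) \<le> s\<^sup>2 + t\<^sup>2"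
      using sum_squares_bound[of "\<bar>s\<bar>" "\<bar>t\<bar>"] by simp
    moreover have "0 \<le> \<bar>s\<bar> * \<bar>t\<bar>" by simp
    ultimately show ?thesis unfolding abs_mult by linarith
  qed
  then show "AE \<omega> in M. norm (f \<omega> * g \<omega>) \<le> norm ((f \<omega>)\<^sup>2 + (g \<omega>)\<^sup>2)"
    by (auto intro!: AE_I2 order_trans[OF _ abs_ge_self])
qed

lemma finite_second_moment_inner:
  fixes X :: "'a \<Rightarrow> 'b::euclidean_space"
  assumes "finite_second_moment M X" "b \<in> Basis"
  shows "finite_second_moment M (\<lambda>\<omega>. X \<omega> \<bullet> b)"
  unfolding finite_second_moment_def
proof
  have X: "X \<in> borel_measurable M" "integrable M (\<lambda>\<omega>. (norm (X \<omega>))\<^sup>2)"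
    using assms by (auto simp: finite_second_moment_def)
  then show m: "(\<lambda>\<omega>. X \<omega> \<bullet> b) \<in> borel_measurable M" by simp
  show "integrable M (\<lambda>\<omega>. (norm (X \<omega> \<bullet> b))\<^sup>2)"
    using X(2)
  proof (rule Bochner_Integration.integrable_bound)
    show "AE \<omega> in M. norm ((norm (X \<omega> \<bullet> b))\<^sup>2) \<le> norm ((norm (X \<omega>))\<^sup>2)"
      using power_mono[OF Basis_le_norm[OF assms(2)], where n = 2] by (intro AE_I2) simp
  qed (use m in simp)
qed

text \<open>Expanding the squared norm of the difference leaves one cross term, linear in
  \<open>X\<close>, which is integrable because square integrability implies integrability on a
  finite measure space.\<close>

lemma finite_second_moment_diff_const:
  fixes X :: "'a \<Rightarrow> 'b::euclidean_space"
  assumes "finite_measure M" "finite_second_moment M X"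
  shows "finite_second_moment M (\<lambda>\<omega>. X \<omega> - c)"
proof -
  interpret finite_measure M by fact
  have "integrable M X" "integrable M (\<lambda>\<omega>. (norm (X \<omega>))\<^sup>2)"
    using integrable_finite_second_moment[OF assms] assms(2)
    by (auto simp: finite_second_moment_def)
  then have "integrable M (\<lambda>\<omega>. (norm (X \<omega>))\<^sup>2 + (norm c)\<^sup>2 - 2 * (X \<omega> \<bullet> c))"
    by simp
  moreover have "(norm (x - c))\<^sup>2 = (norm x)\<^sup>2 + (norm c)\<^sup>2 - 2 * (x \<bullet> c)" for x
    by (simp add: power2_norm_eq_inner inner_diff inner_commute)
  ultimately show ?thesis
    using assms(2) by (auto simp: finite_second_moment_def)
qed

text \<open>Additivity of the variance for centred variables: after expanding the square,
  independence factors the expectation of each off-diagonal product into a product of means, which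
  is 0.\<close>

lemma (in prob_space) expectation_square_sum_indep:
  fixes Y :: "'i \<Rightarrow> 'a \<Rightarrow> real"
  assumes I: "finite I" and indep: "indep_vars (\<lambda>_. borel) Y I"
    and moment: "\<And>i. i \<in> I \<Longrightarrow> finite_second_moment M (Y i)"
    and mean: "\<And>i. i \<in> I \<Longrightarrow> expectation (Y i) = 0"
  shows "integrable M (\<lambda>\<omega>. (\<Sum>i\<in>I. Y i \<omega>)\<^sup>2)"
    and "expectation (\<lambda>\<omega>. (\<Sum>i\<in>I. Y i \<omega>)\<^sup>2) = (\<Sum>i\<in>I. expectation (\<lambda>\<omega>. (Y i \<omega>)\<^sup>2))"
proof -
  have prod: "integrable M (\<lambda>\<omega>. Y i \<omega> * Y j \<omega>)" if "i \<in> I" "j \<in> I" for i j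
    using that by (intro integrable_finite_second_moment_mult moment)
  have int: "integrable M (Y i)" if "i \<in> I" for i
    using that by (intro integrable_finite_second_moment moment) unfold_locales
  have sq: "(\<Sum>i\<in>I. Y i \<omega>)\<^sup>2 = (\<Sum>i\<in>I. \<Sum>j\<in>I. Y i \<omega> * Y j \<omega>)" for \<omega>
    by (simp add: power2_eq_square sum_product)
  show "integrable M (\<lambda>\<omega>. (\<Sum>i\<in>I. Y i \<omega>)\<^sup>2)"
    unfolding sq by (intro Bochner_Integration.integrable_sum prod)
  have cross: "expectation (\<lambda>\<omega>. Y i \<omega> * Y j \<omega>) = (if j = i then expectation (\<lambda>\<omega>. (Y i \<omega>)\<^sup>2) else 0)"
    if ij: "i \<in> I" "j \<in> I" for i j
  proof (cases "j = i")
    case False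
    \<comment> \<open>The product of two variables is written as a product over the index set {i,
      j}, the form in which independence is available; since i and j differ, this set has exactly
      two elements.\<close>
    have "expectation (\<lambda>\<omega>. \<Prod>k\<in>{i, j}. Y k \<omega>) = (\<Prod>k\<in>{i, j}. expectation (Y k))"
      using ij int by (intro indep_vars_lebesgue_integral indep_vars_subset[OF indep]) auto
    with False show ?thesis
      using mean ij by simp
  qed (simp add: power2_eq_square)
  have "expectation (\<lambda>\<omega>. (\<Sum>i\<in>I. Y i \<omega>)\<^sup>2)
      = (\<Sum>i\<in>I. \<Sum>j\<in>I. expectation (\<lambda>\<omega>. Y i \<omega> * Y j \<omega>))"
    unfolding sq using prod
    by (subst Bochner_Integration.integral_sum; simp add: Bochner_Integration.integral_sum)
  also have "\<dots> = (\<Sum>i\<in>I. expectation (\<lambda>\<omega>. (Y i \<omega>)\<^sup>2))"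
    using I by (simp add: cross cong: sum.cong)
  finally show "expectation (\<lambda>\<omega>. (\<Sum>i\<in>I. Y i \<omega>)\<^sup>2) = (\<Sum>i\<in>I. expectation (\<lambda>\<omega>. (Y i \<omega>)\<^sup>2))" .
qed

lemma norm_square_eq_sum_Basis:
  fixes x :: "'a::euclidean_space"
  shows "(norm x)\<^sup>2 = (\<Sum>b\<in>Basis. (x \<bullet> b)\<^sup>2)"
  unfolding power2_norm_eq_inner by (subst euclidean_inner) (simp add: power2_eq_square)

text \<open>Both sides are integrals against the common law on the Borel sets. This carries moments
  of \<open>X\<close> over to samples that live on another probability space.\<close>

lemma integral_distr_eq:
  fixes f :: "'b::{real_normed_vector, second_countable_topology} \<Rightarrow> 'c::{banach, second_countable_topology}"
  assumes "X \<in> borel_measurable M" "Y \<in> borel_measurable M'" "distr M' borel Y = distr M borel X"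
    and f: "f \<in> borel_measurable borel"
  shows "(\<integral>\<omega>. f (Y \<omega>) \<partial>M') = (\<integral>\<omega>. f (X \<omega>) \<partial>M)"
    and "integrable M' (\<lambda>\<omega>. f (Y \<omega>)) \<longleftrightarrow> integrable M (\<lambda>\<omega>. f (X \<omega>))"
  using integral_distr[OF assms(1) f] integral_distr[OF assms(2) f]
    integrable_distr_eq[OF assms(1) f] integrable_distr_eq[OF assms(2) f] assms(3)
  by simp_all

text \<open>Coordinate by coordinate, the centred samples are independent with mean 0, so the
  squares of their sum add up to n times the variance; the factor 1/n^2 from averaging leaves
  1/n.\<close>

lemma empirical_mean_error:
  fixes X :: "'a \<Rightarrow> 'b::euclidean_space"
  assumes M: "prob_space M" and X: "finite_second_moment M X" and mean: "(\<integral>\<omega>. X \<omega> \<partial>M) = m"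
    and n: "n \<ge> 1" and S: "iid_samples M X M' n S"
  shows "(\<integral>\<omega>. (norm (empirical_mean n S \<omega> - m))\<^sup>2 \<partial>M') = (\<integral>\<omega>. (norm (X \<omega> - m))\<^sup>2 \<partial>M) / real n"
proof -
  interpret M: prob_space M by fact
  interpret M': prob_space M' using S by (simp add: iid_samples_def)
  have fin: "finite_measure M" "finite_measure M'" by unfold_locales
  have indep: "M'.indep_vars (\<lambda>_. borel) S {..<n}"
    and distr: "\<And>k. k < n \<Longrightarrow> distr M' borel (S k) = distr M borel X"
    using S by (auto simp: iid_samples_def)
  have Sm: "S k \<in> borel_measurable M'" if "k < n" for k
    using indep that by (auto simp: M'.indep_vars_def)
  have Xm: "X \<in> borel_measurable M" using X by (simp add: finite_second_moment_def)
  \<comment> \<open>\<open>Sm\<close> and \<open>distr\<close> each carry the premise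
    \<open>k < n\<close>, so every use of \<open>transfer\<close> discharges it twice.\<close>
  note transfer = integral_distr_eq[OF Xm Sm distr]
  define Y where "Y b k \<omega> = (S k \<omega> - m) \<bullet> b" for b k \<omega>
  have Xint: "integrable M X" by (rule integrable_finite_second_moment[OF fin(1) X])
  have XY: "finite_second_moment M (\<lambda>\<omega>. (X \<omega> - m) \<bullet> b)" if "b \<in> Basis" for b
    using that by (intro finite_second_moment_inner finite_second_moment_diff_const fin X)
  have Y_moment: "finite_second_moment M' (Y b k)" if "b \<in> Basis" "k < n" for b k
    using XY[OF that(1)] transfer(2)[OF that(2) that(2), of "\<lambda>x. (norm ((x - m) \<bullet> b))\<^sup>2"] Sm[OF that(2)]
    by (simp add: finite_second_moment_def Y_def[abs_def])
  have Y_mean: "M'.expectation (Y b k) = 0" if "b \<in> Basis" "k < n" for b k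
  proof -
    have "M'.expectation (Y b k) = (\<integral>\<omega>. (X \<omega> - m) \<bullet> b \<partial>M)"
      using transfer(1)[OF that(2) that(2), of "\<lambda>x. (x - m) \<bullet> b"] by (simp add: Y_def[abs_def])
    also have "\<dots> = 0"
      using Xint mean by (simp add: M.prob_space)
    finally show ?thesis .
  qed
  have Y_sq: "M'.expectation (\<lambda>\<omega>. (Y b k \<omega>)\<^sup>2) = (\<integral>\<omega>. ((X \<omega> - m) \<bullet> b)\<^sup>2 \<partial>M)" if "k < n" for b k
    using transfer(1)[OF that that, of "\<lambda>x. ((x - m) \<bullet> b)\<^sup>2"] by (simp add: Y_def)
  have Y_indep: "M'.indep_vars (\<lambda>_. borel) (Y b) {..<n}" for b
    unfolding Y_def[abs_def] by (rule M'.indep_vars_compose2[OF indep]) simp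
  note sum_Y = M'.expectation_square_sum_indep[OF finite_lessThan Y_indep]
  \<comment> \<open>As n is positive, m is itself the average of n copies of m, so centring the mean
    is the same as centring each sample.\<close>
  have "empirical_mean n S \<omega> - m = (1 / real n) *\<^sub>R (\<Sum>k<n. S k \<omega> - m)" for \<omega>
    using n by (simp add: empirical_mean_def sum_subtractf scaleR_diff_right sum_constant_scaleR)
  then have eq: "(norm (empirical_mean n S \<omega> - m))\<^sup>2 = (\<Sum>b\<in>Basis. (\<Sum>k<n. Y b k \<omega>)\<^sup>2 / (real n)\<^sup>2)" for \<omega>
    by (subst norm_square_eq_sum_Basis)
      (simp add: Y_def inner_sum_left power_mult_distrib power_divide)
  have "(\<integral>\<omega>. (norm (empirical_mean n S \<omega> - m))\<^sup>2 \<partial>M')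
      = (\<Sum>b\<in>Basis. (\<integral>\<omega>. (\<Sum>k<n. Y b k \<omega>)\<^sup>2 \<partial>M') / (real n)\<^sup>2)"
    unfolding eq using sum_Y(1) Y_moment Y_mean
    by (subst Bochner_Integration.integral_sum) auto
  also have "\<dots> = (\<Sum>b\<in>Basis. real n * (\<integral>\<omega>. ((X \<omega> - m) \<bullet> b)\<^sup>2 \<partial>M) / (real n)\<^sup>2)"
  proof (rule sum.cong[OF refl])
    fix b :: 'b assume "b \<in> Basis"
    then have "(\<integral>\<omega>. (\<Sum>k<n. Y b k \<omega>)\<^sup>2 \<partial>M') = (\<Sum>k<n. \<integral>\<omega>. (Y b k \<omega>)\<^sup>2 \<partial>M')"
      by (intro sum_Y(2) Y_moment Y_mean) auto
    also have "\<dots> = real n * (\<integral>\<omega>. ((X \<omega> - m) \<bullet> b)\<^sup>2 \<partial>M)"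
      by (simp add: Y_sq)
    finally show "(\<integral>\<omega>. (\<Sum>k<n. Y b k \<omega>)\<^sup>2 \<partial>M') / (real n)\<^sup>2
        = real n * (\<integral>\<omega>. ((X \<omega> - m) \<bullet> b)\<^sup>2 \<partial>M) / (real n)\<^sup>2"
      by simp
  qed
  also have "\<dots> = (\<Sum>b\<in>Basis. \<integral>\<omega>. ((X \<omega> - m) \<bullet> b)\<^sup>2 \<partial>M) / real n"
    using n by (simp add: sum_divide_distrib power2_eq_square)
  also have "(\<Sum>b\<in>Basis. \<integral>\<omega>. ((X \<omega> - m) \<bullet> b)\<^sup>2 \<partial>M) = (\<integral>\<omega>. (norm (X \<omega> - m))\<^sup>2 \<partial>M)"
    unfolding norm_square_eq_sum_Basis using XY
    by (subst Bochner_Integration.integral_sum) (auto simp: finite_second_moment_def)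
  finally show ?thesis .
qed

section \<open>Conditionally unbiased estimators\<close>

text \<open>Unbiasedness makes \<open>g\<close> the conditional expectation of \<open>f\<close>,
  that is, its orthogonal projection in L2. Hence \<open>f - g\<close> is orthogonal to
  \<open>g - c\<close>, and by Pythagoras the two errors differ by the integral of (f - g)^2. The
  function \<open>p\<close> is a version of \<open>g\<close> that is measurable for \<open>F\<close>
  everywhere, not merely up to a null set.\<close>

lemma (in sigma_finite_subalgebra) integral_square_cond_exp_le:
  assumes "finite_measure M"
    and f: "finite_second_moment M f" and g: "finite_second_moment M g"
    and p: "p \<in> borel_measurable F" "AE \<omega> in M. g \<omega> = p \<omega>"
    and unbiased: "AE \<omega> in M. real_cond_exp M F f \<omega> = real_cond_exp M F g \<omega>"
  shows "(\<integral>\<omega>. f \<omega> \<partial>M) = (\<integral>\<omega>. g \<omega> \<partial>M)"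
    and "(\<integral>\<omega>. (g \<omega> - c)\<^sup>2 \<partial>M) \<le> (\<integral>\<omega>. (f \<omega> - c)\<^sup>2 \<partial>M)"
proof -
  have fi: "integrable M f" and gi: "integrable M g"
    using integrable_finite_second_moment assms by auto
  have [measurable]: "f \<in> borel_measurable M" "g \<in> borel_measurable M" "p \<in> borel_measurable M"
    using f g measurable_from_subalg[OF subalg p(1)] by (auto simp: finite_second_moment_def)
  have "integrable M p"
    using gi p(2) by (subst integrable_cong_AE[of p M g]) auto
  then have "AE \<omega> in M. real_cond_exp M F p \<omega> = p \<omega>"
    using p(1) by simp
  moreover have "AE \<omega> in M. real_cond_exp M F g \<omega> = real_cond_exp M F p \<omega>"
    by (rule real_cond_exp_cong) (use p(2) in auto)
  ultimately have ce: "AE \<omega> in M. real_cond_exp M F f \<omega> = g \<omega>"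
    using unbiased p(2) by eventually_elim simp
  have "(\<integral>\<omega>. f \<omega> \<partial>M) = (\<integral>\<omega>. real_cond_exp M F f \<omega> \<partial>M)"
    using fi by (simp add: real_cond_exp_int)
  also have "\<dots> = (\<integral>\<omega>. g \<omega> \<partial>M)"
    using ce by (intro integral_cong_AE) auto
  finally show "(\<integral>\<omega>. f \<omega> \<partial>M) = (\<integral>\<omega>. g \<omega> \<partial>M)" .

  define f' g' where "f' = (\<lambda>\<omega>. f \<omega> - c)" and "g' = (\<lambda>\<omega>. g \<omega> - c)"
  have f': "finite_second_moment M f'" and g': "finite_second_moment M g'"
    unfolding f'_def g'_def using assms by (auto intro: finite_second_moment_diff_const)
  have [measurable]: "f' \<in> borel_measurable M" "g' \<in> borel_measurable M"
    unfolding f'_def g'_def by simp_all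
  have i: "integrable M (\<lambda>\<omega>. g' \<omega> * f \<omega>)" "integrable M (\<lambda>\<omega>. g' \<omega> * g \<omega>)"
    using f g g' by (auto intro: integrable_finite_second_moment_mult)
  \<comment> \<open>Taking a factor out of a conditional expectation requires it to be measurable
    for \<open>F\<close>. The orthogonality relation is therefore proved with \<open>p\<close> in
    place of \<open>g\<close> and then transferred along the almost sure equality.\<close>
  have "integrable M (\<lambda>\<omega>. (p \<omega> - c) * f \<omega>)"
    using i(1) p(2) by (subst integrable_cong_AE[of _ M "\<lambda>\<omega>. g' \<omega> * f \<omega>"]) (auto simp: g'_def)
  then have "(\<integral>\<omega>. (p \<omega> - c) * real_cond_exp M F f \<omega> \<partial>M) = (\<integral>\<omega>. (p \<omega> - c) * f \<omega> \<partial>M)"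
    using p(1) by (intro real_cond_exp_intg) auto
  moreover have "(\<integral>\<omega>. (p \<omega> - c) * real_cond_exp M F f \<omega> \<partial>M) = (\<integral>\<omega>. g' \<omega> * g \<omega> \<partial>M)"
    using p(2) ce by (intro integral_cong_AE) (auto simp: g'_def)
  moreover have "(\<integral>\<omega>. (p \<omega> - c) * f \<omega> \<partial>M) = (\<integral>\<omega>. g' \<omega> * f \<omega> \<partial>M)"
    using p(2) by (intro integral_cong_AE) (auto simp: g'_def)
  ultimately have orth: "(\<integral>\<omega>. g' \<omega> * f \<omega> \<partial>M) = (\<integral>\<omega>. g' \<omega> * g \<omega> \<partial>M)"
    by simp
  have sq: "integrable M (\<lambda>\<omega>. (f' \<omega>)\<^sup>2)" "integrable M (\<lambda>\<omega>. (g' \<omega>)\<^sup>2)"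
    using f' g' by (auto simp: finite_second_moment_def)
  \<comment> \<open>The added term has integral 0 by \<open>orth\<close>. It is chosen so that the
    two integrands differ by the perfect square (f - g)^2, which reduces the claim to a pointwise
    inequality.\<close>
  have "(\<integral>\<omega>. (g' \<omega>)\<^sup>2 \<partial>M) = (\<integral>\<omega>. (g' \<omega>)\<^sup>2 + 2 * (g' \<omega> * f \<omega> - g' \<omega> * g \<omega>) \<partial>M)"
    using sq i orth by simp
  also have "\<dots> \<le> (\<integral>\<omega>. (f' \<omega>)\<^sup>2 \<partial>M)"
  proof (rule integral_mono)
    fix \<omega>
    have "(f' \<omega>)\<^sup>2 - ((g' \<omega>)\<^sup>2 + 2 * (g' \<omega> * f \<omega> - g' \<omega> * g \<omega>)) = (f \<omega> - g \<omega>)\<^sup>2"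
      by (simp add: f'_def g'_def power2_eq_square algebra_simps)
    then show "(g' \<omega>)\<^sup>2 + 2 * (g' \<omega> * f \<omega> - g' \<omega> * g \<omega>) \<le> (f' \<omega>)\<^sup>2"
      using zero_le_power2[of "f \<omega> - g \<omega>"] by linarith
  qed (use sq i in auto)
  finally show "(\<integral>\<omega>. (g \<omega> - c)\<^sup>2 \<partial>M) \<le> (\<integral>\<omega>. (f \<omega> - c)\<^sup>2 \<partial>M)"
    by (simp add: f'_def g'_def)
qed

section \<open>Deterministic fully connected networks\<close>

text \<open>The joint differentiability in observation and parameter is composed with the embedding
  of a slice with fixed parameter.\<close>

lemma node_fun_differentiable_obs:
  assumes "local_functions N" "0 < layer N v"
  shows "(\<lambda>z. node_fun N v z t) differentiable (at z)"
proof -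
  have "(\<lambda>(z', t'). node_fun N v z' t') differentiable (at (z, t))"
    using assms unfolding local_functions_def by blast
  then have "((\<lambda>(z', t'). node_fun N v z' t') \<circ> (\<lambda>z. (z, t))) differentiable (at z)"
    by (intro differentiable_chain_at differentiableI[OF has_derivative_Pair])
      (auto intro: has_derivative_ident has_derivative_const)
  then show ?thesis by (simp add: o_def)
qed

lemma node_fun_differentiable_param:
  assumes "local_functions N" "0 < layer N v"
  shows "node_fun N v z differentiable (at t)"
proof -
  have "(\<lambda>(z', t'). node_fun N v z' t') differentiable (at (z, t))"
    using assms unfolding local_functions_def by blast
  then have "((\<lambda>(z', t'). node_fun N v z' t') \<circ> (\<lambda>t. (z, t))) differentiable (at t)"
    by (intro differentiable_chain_at differentiableI[OF has_derivative_Pair])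
      (auto intro: has_derivative_ident has_derivative_const)
  then show ?thesis by (simp add: o_def)
qed

lemma continuous_on_node_fun:
  assumes "local_functions N" "0 < layer N v"
  shows "continuous_on UNIV (\<lambda>z. node_fun N v z t)"
  using node_fun_differentiable_obs[OF assms]
  by (auto intro!: differentiable_imp_continuous_on simp: differentiable_on_def
      intro: differentiable_at_withinI)

lemma borel_measurable_node_fun:
  assumes "local_functions N" "0 < layer N v"
  shows "(\<lambda>z. node_fun N v z t) \<in> borel_measurable borel"
  by (intro borel_measurable_continuous_onI continuous_on_node_fun assms)

lemma borel_measurable_jac_param:
  assumes "local_functions N" "0 < layer N v"
  shows "jac_param N v \<in> borel_measurable borel"
  unfolding jac_param_def[abs_def]
  by (intro borel_measurable_transpose borel_measurable_jacobian borel_measurable_node_fun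
      node_fun_differentiable_param assms)

text \<open>Here the differentiated map varies only slot \<open>v\<close> of the observation, with
  base point \<open>fst z $ v\<close>. Two facts about this substitution are needed: for fixed
  \<open>z\<close> it is differentiable in the inserted vector, and for a fixed shift it is
  measurable in \<open>z\<close>.\<close>

lemma borel_measurable_jac_act:
  fixes N :: "('v::finite, 'k::finite, 'p::finite, 'q::finite, 'w) network"
  assumes "local_functions N" "0 < layer N w"
  shows "jac_act N v w \<in> borel_measurable borel"
  unfolding jac_act_def[abs_def]
proof (intro borel_measurable_transpose borel_measurable_jacobian)
  fix z :: "(real ^ 'k ^ 'v) \<times> (real ^ 'q)" and y :: "real ^ 'k"
  let ?e = "\<lambda>y. (\<chi> u. if u = v then y else fst z $ u, snd z)"
  \<comment> \<open>Inserting \<open>y\<close> into slot \<open>v\<close> is affine: the observation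
    with that slot emptied, plus the linear map \<open>axis v\<close>.\<close>
  have "?e = (\<lambda>y. ((\<chi> u. if u = v then 0 else fst z $ u) + axis v y, snd z))"
    by (auto simp: fun_eq_iff vec_eq_iff axis_def)
  moreover have "bounded_linear (axis v :: real ^ 'k \<Rightarrow> real ^ 'k ^ 'v)"
    by (rule linear_conv_bounded_linear[THEN iffD1], rule linearI) (auto simp: vec_eq_iff axis_def)
  ultimately have "?e differentiable (at y)"
    by (auto intro!: differentiableI[OF has_derivative_Pair] has_derivative_const
        has_derivative_add bounded_linear_imp_has_derivative)
  then have "((\<lambda>z. node_fun N w z (param N w)) \<circ> ?e) differentiable (at y)"
    by (intro differentiable_chain_at node_fun_differentiable_obs assms)
  then show "(\<lambda>y. node_fun N w (?e y) (param N w)) differentiable (at y)"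
    by (simp add: o_def)
next
  fix h :: "real ^ 'k"
  \<comment> \<open>This map adds \<open>h\<close> to slot \<open>v\<close> of the observation and
    is continuous.\<close>
  let ?e = "\<lambda>z :: (real ^ 'k ^ 'v) \<times> (real ^ 'q). (\<chi> u. if u = v then fst z $ v + h else fst z $ u, snd z)"
  have "?e \<in> borel_measurable borel"
  proof (intro borel_measurable_continuous_onI continuous_on_Pair continuous_on_vec_lambda)
    show "continuous_on UNIV (\<lambda>z :: (real ^ 'k ^ 'v) \<times> (real ^ 'q).
        if u = v then fst z $ v + h else fst z $ u)" for u
      by (cases "u = v") (auto intro!: continuous_intros)
  qed (intro continuous_intros)
  then show "(\<lambda>z. node_fun N w (?e z) (param N w)) \<in> borel_measurable borel"
    by (rule measurable_compose[OF _ borel_measurable_node_fun[OF assms]])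
qed

text \<open>Both nodes have the whole preceding layer as parents and see no noise. The layer must be
  positive, since input nodes store their own vectors, in different slots.\<close>

lemma obs_same_layer:
  assumes "\<And>u. 0 < layer N u \<Longrightarrow> parents N u = {u'. layer N u' = layer N u - 1}"
    and "noisy N = {}" "0 < layer N v" "layer N u = layer N v"
  shows "obs N u = obs N v"
  using assms by (auto simp: obs_def fun_eq_iff)

text \<open>Backward induction from the terminal layer. There the feedback is a function of the
  activation, which is a function of the observation. Below it, the backpropagation sum involves
  only observations and gradients of children; the gradients are functions of the children's
  observations by induction, and these observations can be computed from that of
  \<open>v\<close>.\<close>

lemma grad_function_of_obs:
  fixes N :: "('v::finite, 'k::finite, 'p::finite, 'q::finite, 'w) network"
  assumes network: "backprop_network N M"
    and terminal: "\<And>u. layer N u = depth N \<Longrightarrow>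
        \<exists>h \<in> borel_measurable borel. AE \<omega> in M. grad N u \<omega> = h (act N u \<omega>)"
    and noise: "noisy N = {}"
    and full: "\<And>u. 0 < layer N u \<Longrightarrow> parents N u = {u'. layer N u' = layer N u - 1}"
    and v: "0 < layer N v"
  shows "\<exists>h \<in> borel_measurable borel. AE \<omega> in M. grad N v \<omega> = h (obs N v \<omega>)"
  using v
proof (induction "depth N - layer N v" arbitrary: v rule: less_induct)
  case less
  have loc: "local_functions N" and depth: "layer N v \<le> depth N"
    and edge: "\<And>u w. (u, w) \<in> edges N \<Longrightarrow> layer N w = Suc (layer N u)"
    and act: "\<And>u \<omega>. \<omega> \<in> space M \<Longrightarrow> 0 < layer N u \<Longrightarrow> act N u \<omega> = node_fun N u (obs N u \<omega>) (param N u)"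
    using network by (auto simp: backprop_network_def layered_graph_def)
  show ?case
  proof (cases "layer N v = depth N")
    case True
    then obtain h where h: "h \<in> borel_measurable borel" "AE \<omega> in M. grad N v \<omega> = h (act N v \<omega>)"
      using terminal by blast
    have "(\<lambda>z. h (node_fun N v z (param N v))) \<in> borel_measurable borel"
      by (rule measurable_compose[OF borel_measurable_node_fun[OF loc less.prems] h(1)])
    moreover have "AE \<omega> in M. grad N v \<omega> = h (node_fun N v (obs N v \<omega>) (param N v))"
      using h(2) AE_space by eventually_elim (simp add: act less.prems)
    ultimately show ?thesis by - (rule bexI[rotated], assumption+)
  next
    case False
    with depth have lt: "layer N v < depth N" by simp
    have child: "layer N w = Suc (layer N v)" if "w \<in> children N v" for w
      using that by (auto simp: children_def edge)
    have "\<exists>h \<in> borel_measurable borel. AE \<omega> in M. grad N w \<omega> = h (obs N w \<omega>)"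
      if "w \<in> children N v" for w
    proof (rule less.hyps)
      show "depth N - layer N w < depth N - layer N v" "0 < layer N w"
        using lt child[OF that] by linarith+
    qed
    then obtain h where h: "\<And>w. w \<in> children N v \<Longrightarrow> h w \<in> borel_measurable borel"
      "\<And>w. w \<in> children N v \<Longrightarrow> AE \<omega> in M. grad N w \<omega> = h w (obs N w \<omega>)"
      using bchoice[of "children N v"
          "\<lambda>w h. h \<in> borel_measurable borel \<and> (AE \<omega> in M. grad N w \<omega> = h (obs N w \<omega>))"]
      by blast
    \<comment> \<open>This rebuilds a child's observation from that of \<open>v\<close>: every node
      in the layer of \<open>v\<close> has the same observation \<open>z\<close>, so evaluating all
      their local functions at \<open>z\<close> yields every parent activation of the child. The
      noise component is 0.\<close>
    define next_obs :: "(real ^ 'k ^ 'v) \<times> (real ^ 'q) \<Rightarrow> (real ^ 'k ^ 'v) \<times> (real ^ 'q)"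
      where "next_obs z = (\<chi> u. if layer N u = layer N v then node_fun N u z (param N u) else 0, 0)" for z
    have next_meas: "next_obs \<in> borel_measurable borel"
      unfolding next_obs_def[abs_def]
    proof (rule borel_measurable_Pair[OF borel_measurable_vec])
      show "(\<lambda>z. (\<chi> u. if layer N u = layer N v then node_fun N u z (param N u) else 0) $ u)
          \<in> borel_measurable borel" for u
        using borel_measurable_node_fun[OF loc, of u] less.prems
        by (cases "layer N u = layer N v") simp_all
    qed simp
    have next_obs: "obs N w \<omega> = next_obs (obs N v \<omega>)" if "w \<in> children N v" "\<omega> \<in> space M" for w \<omega>
    proof -
      have "act N u \<omega> = node_fun N u (obs N v \<omega>) (param N u)" if "layer N u = layer N v" for u
        using act[OF \<open>\<omega> \<in> space M\<close>, of u] obs_same_layer[OF full noise less.prems that] that less.prems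
        by simp
      then show ?thesis
        using child[OF that(1)] by (auto simp: obs_def[of N w] next_obs_def full noise vec_eq_iff)
    qed
    let ?g = "\<lambda>z. \<Sum>w\<in>children N v. jac_act N v w (next_obs z) *v h w (next_obs z)"
    have "?g \<in> borel_measurable borel"
      using child h(1)
      by (intro borel_measurable_sum borel_measurable_matrix_vector_mult
          measurable_compose[OF next_meas] borel_measurable_jac_act loc) auto
    \<comment> \<open>There are finitely many children, so their exceptional null sets combine into
      one.\<close>
    moreover have "AE \<omega> in M. \<forall>w\<in>children N v. grad N w \<omega> = h w (obs N w \<omega>)"
      using h(2) by (intro AE_finite_allI) auto
    then have "AE \<omega> in M. grad N v \<omega> = ?g (obs N v \<omega>)"
      using AE_space
    proof eventually_elim
      case (elim \<omega>)
      have "grad N v \<omega> = (\<Sum>w\<in>children N v. jac_act N v w (obs N w \<omega>) *v grad N w \<omega>)"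
        using network lt elim(2) by (auto simp: backprop_network_def)
      also have "\<dots> = ?g (obs N v \<omega>)"
        using elim by (intro sum.cong) (auto simp: next_obs)
      finally show ?case .
    qed
    ultimately show ?thesis by - (rule bexI[rotated], assumption+)
  qed
qed

text \<open>Conditioning on the single observation of \<open>v\<close> is conditioning on a
  pulled-back Borel sigma-algebra, for which measurability of the observation and the subalgebra
  property are standard.\<close>

lemma obs_algebra_singleton: "obs_algebra N M {v} = vimage_algebra (space M) (obs N v) borel"
  by (simp add: obs_algebra_def vimage_algebra_def)

lemma borel_measurable_obs:
  assumes "\<And>u. act N u \<in> borel_measurable M" "noisy N = {}"
  shows "obs N v \<in> borel_measurable M"
proof (cases "layer N v = 0")
  case True
  have "(\<lambda>\<omega>. \<chi> u. if u = v then act N v \<omega> else 0) \<in> borel_measurable M"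
  proof (rule borel_measurable_vec)
    show "(\<lambda>\<omega>. (\<chi> u. if u = v then act N v \<omega> else 0) $ u) \<in> borel_measurable M" for u
      by (cases "u = v") (simp_all add: assms(1))
  qed
  with True show ?thesis
    by (simp add: obs_def[abs_def] borel_measurable_Pair)
next
  case False
  have "(\<lambda>\<omega>. \<chi> u. if u \<in> parents N v then act N u \<omega> else 0) \<in> borel_measurable M"
  proof (rule borel_measurable_vec)
    show "(\<lambda>\<omega>. (\<chi> u. if u \<in> parents N v then act N u \<omega> else 0) $ u) \<in> borel_measurable M" for u
      by (cases "u \<in> parents N v") (simp_all add: assms(1))
  qed
  with False show ?thesis
    by (simp add: obs_def[abs_def] assms(2) borel_measurable_Pair)
qed

theorem theorem1:
  fixes M :: "'w measure"
    and N :: "('v::finite, 'k::finite, 'p::finite, 'q::finite, 'w) network"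
    and v :: 'v
    and gt :: "'w \<Rightarrow> real ^ 'p"
    and n :: nat
    and M1 :: "'w1 measure" and S1 :: "nat \<Rightarrow> 'w1 \<Rightarrow> real ^ 'p"
    and M2 :: "'w2 measure" and S2 :: "nat \<Rightarrow> 'w2 \<Rightarrow> real ^ 'p"
  assumes network: "backprop_network N M"
    and not_A1: "\<And>u. layer N u = depth N \<Longrightarrow>
        \<exists>h \<in> borel_measurable borel. AE \<omega> in M. grad N u \<omega> = h (act N u \<omega>)"
    and not_A2: "noisy N = {}"
    and not_A3: "\<And>u. 0 < layer N u \<Longrightarrow> parents N u = {u'. layer N u' = layer N u - 1}"
    and B: "\<And>u U. 0 < layer N u \<Longrightarrow> U \<subseteq> an_sib N u \<Longrightarrow>
        AE \<omega> in M. vec_cond_exp M (obs_algebra N M {u}) (grad N u) \<omega> =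
                   vec_cond_exp M (obs_algebra N M (insert u U)) (grad N u) \<omega>"
    and v: "0 < layer N v"
    and gt_moment: "finite_second_moment M gt"
    and gt_range: "\<And>\<omega>. \<omega> \<in> space M \<Longrightarrow> gt \<omega> \<in> coord_space (pcoords N v)"
    and gt_unbiased: "AE \<omega> in M. vec_cond_exp M (obs_algebra N M {v}) gt \<omega> =
                                 vec_cond_exp M (obs_algebra N M {v}) (param_grad N v) \<omega>"
    and n: "n \<ge> 1"
    and S1: "iid_samples M gt M1 n S1"
    and S2: "iid_samples M (param_grad N v) M2 n S2"
  shows "(\<integral>\<omega>. (norm (empirical_mean n S1 \<omega> - (\<integral>\<omega>'. param_grad N v \<omega>' \<partial>M)))\<^sup>2 \<partial>M1)
       \<ge> (\<integral>\<omega>. (norm (empirical_mean n S2 \<omega> - (\<integral>\<omega>'. param_grad N v \<omega>' \<partial>M)))\<^sup>2 \<partial>M2)"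
proof -
  have prob: "prob_space M" and loc: "local_functions N"
    and act: "\<And>u. act N u \<in> borel_measurable M"
    and pg_moment: "finite_second_moment M (param_grad N v)"
    using network v by (auto simp: backprop_network_def finite_second_moment_def)
  interpret prob_space M by fact
  define F where "F = obs_algebra N M {v}"
  have obs_F: "obs N v \<in> borel_measurable F"
    unfolding F_def obs_algebra_singleton by (rule measurable_vimage_algebra1) simp
  have "subalgebra M F"
    unfolding F_def obs_algebra_singleton subalgebra_def
    by (simp add: sets_image_in_sets borel_measurable_obs[OF act not_A2])
  then interpret finite_measure_subalgebra M F
    by unfold_locales
  obtain h where h: "h \<in> borel_measurable borel" "AE \<omega> in M. grad N v \<omega> = h (obs N v \<omega>)"
    using grad_function_of_obs[OF network not_A1 not_A2 not_A3 v] by blast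
  \<comment> \<open>This version of the parameter gradient depends on the sample point only through
    the observation of \<open>v\<close>, so it is measurable for \<open>F\<close>
    everywhere.\<close>
  define p where "p \<omega> = jac_param N v (obs N v \<omega>) *v h (obs N v \<omega>)" for \<omega>
  have p_F: "p \<in> borel_measurable F"
    unfolding p_def[abs_def]
    by (intro borel_measurable_matrix_vector_mult measurable_compose[OF obs_F]
        borel_measurable_jac_param loc v h)
  have p_eq: "AE \<omega> in M. param_grad N v \<omega> = p \<omega>"
    using h(2) by eventually_elim (simp add: param_grad_def p_def)
  have gt_int: "integrable M gt" and pg_int: "integrable M (param_grad N v)"
    using gt_moment pg_moment by (auto intro: integrable_finite_second_moment finite_measure_axioms)
  \<comment> \<open>The projection argument is scalar, so it is applied to each coordinate; a basis
    vector of the parameter space is some \<open>axis i 1\<close>, which matches the componentwise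
    definition of the vector conditional expectation.\<close>
  have comp: "(\<integral>\<omega>. gt \<omega> \<bullet> b \<partial>M) = (\<integral>\<omega>. param_grad N v \<omega> \<bullet> b \<partial>M)"
      "(\<integral>\<omega>. (param_grad N v \<omega> \<bullet> b - c)\<^sup>2 \<partial>M) \<le> (\<integral>\<omega>. (gt \<omega> \<bullet> b - c)\<^sup>2 \<partial>M)"
    if b: "b \<in> Basis" for b c
  proof -
    obtain i where i: "b = axis i 1"
      using b by (auto simp: Basis_vec_def)
    have "AE \<omega> in M. real_cond_exp M F (\<lambda>\<omega>. gt \<omega> \<bullet> b) \<omega>
        = real_cond_exp M F (\<lambda>\<omega>. param_grad N v \<omega> \<bullet> b) \<omega>"
      using gt_unbiased
      by eventually_elim (simp add: F_def vec_cond_exp_def vec_eq_iff i inner_axis)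
    moreover have "(\<lambda>\<omega>. p \<omega> \<bullet> b) \<in> borel_measurable F"
      using p_F by simp
    moreover have "AE \<omega> in M. param_grad N v \<omega> \<bullet> b = p \<omega> \<bullet> b"
      using p_eq by eventually_elim simp
    ultimately show "(\<integral>\<omega>. gt \<omega> \<bullet> b \<partial>M) = (\<integral>\<omega>. param_grad N v \<omega> \<bullet> b \<partial>M)"
      "(\<integral>\<omega>. (param_grad N v \<omega> \<bullet> b - c)\<^sup>2 \<partial>M) \<le> (\<integral>\<omega>. (gt \<omega> \<bullet> b - c)\<^sup>2 \<partial>M)"
      using integral_square_cond_exp_le[OF finite_measure_axioms
          finite_second_moment_inner[OF gt_moment b] finite_second_moment_inner[OF pg_moment b]]
      by blast+
  qed
  define m where "m = (\<integral>\<omega>. param_grad N v \<omega> \<partial>M)"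
  \<comment> \<open>Conditional unbiasedness implies equal unconditional means. Thus both empirical
    means are centred at their own expectation \<open>m\<close>, as the 1/n formula
    requires.\<close>
  have gt_mean: "(\<integral>\<omega>. gt \<omega> \<partial>M) = m"
  proof (rule euclidean_eqI)
    fix b :: "real ^ 'p" assume "b \<in> Basis"
    then show "(\<integral>\<omega>. gt \<omega> \<partial>M) \<bullet> b = m \<bullet> b"
      using comp(1)[of b]
      by (simp only: m_def integral_inner_left[OF gt_int] integral_inner_left[OF pg_int])
  qed
  \<comment> \<open>The squared distance to \<open>m\<close> splits into coordinate errors, so that
    \<open>comp(2)\<close> can be summed over the basis, with the corresponding coordinate of
    \<open>m\<close> as the constant.\<close>
  have split: "(\<integral>\<omega>. (norm (X \<omega> - m))\<^sup>2 \<partial>M) = (\<Sum>b\<in>Basis. \<integral>\<omega>. (X \<omega> \<bullet> b - m \<bullet> b)\<^sup>2 \<partial>M)"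
    if "finite_second_moment M X" for X
    unfolding norm_square_eq_sum_Basis
    using finite_second_moment_inner[OF finite_second_moment_diff_const[OF finite_measure_axioms that]]
    by (subst Bochner_Integration.integral_sum) (auto simp: finite_second_moment_def inner_diff_left)
  have "(\<integral>\<omega>. (norm (param_grad N v \<omega> - m))\<^sup>2 \<partial>M) \<le> (\<integral>\<omega>. (norm (gt \<omega> - m))\<^sup>2 \<partial>M)"
    unfolding split[OF gt_moment] split[OF pg_moment] by (intro sum_mono comp(2))
  then show ?thesis
    unfolding m_def[symmetric] empirical_mean_error[OF prob gt_moment gt_mean n S1]
      empirical_mean_error[OF prob pg_moment m_def[symmetric] n S2]
    by (simp add: divide_right_mono)
qed

end
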